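(* Let $d\ge 1$ be an integer. For every $T\ge1$ and every (possibly adaptively chosen) sequence of loss vectors $c_1,\dots,c_T\in[-1,1]^d$, the alternation-aware Hedge algorithm over $\Delta_d$ (defined in the context) produces $x_1,\dots,x_T\in\Delta_d$ with $$\mathrm{Reg}_{\mathrm{Alt}}^T\le 8\log d .$$
   Context: $\Delta_d=\{x\in\mathbb R^d: x_i\ge0,\ \sum_i x_i=1\}$. In each round $t\ge1$ the learner chooses $x_t\in\Delta_d$ from the past losses $c_1,\dots,c_{t-1}$; then $c_t\in[-1,1]^d$ is chosen (possibly depending on $x_1,\dots,x_t$) and revealed. Set $c_0=0$. The alternating regret is $$\mathrm{Reg}_{\mathrm{Alt}}^T=\sum_{t=1}^T(c_{t-1}+c_t)^\top x_t-\min_{x\in\Delta_d}\sum_{t=1}^T(c_{t-1}+c_t)^\top x .$$ Alternation-aware Hedge algorithm: set $\eta=1/8$, $\beta=1/32$, $L_0=0\in\mathbb R^d$. For $t=1,2,\dots$: (1) let $\theta_t$ be the unique maximizer over $\theta\in\mathbb R$ of $\log\sum_{i=1}^d\exp[-\eta L_{t-1,i}-\beta(c_{t-1,i}-\theta)^2]$; (2) let $p_t\in\Delta_d$ be given by $p_{t,i}\propto\exp[-\eta L_{t-1,i}-\beta(c_{t-1,i}-\theta_t)^2]$; (3) play $x_t$ with $x_{t,i}=p_{t,i}\bigl(1-\tfrac{c_{t-1,i}-\theta_t}{2}\bigr)$; (4) observe $c_t$ and set $L_t=L_{t-1}+c_{t-1}+c_t$. *)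

theory Defs
  imports "HOL-Analysis.Analysis"
begin

definition prob_simplex :: "(real ^ 'd::finite) set" where
  "prob_simplex = {x. (\<forall>i. 0 \<le> x $ i) \<and> (\<Sum>i\<in>UNIV. x $ i) = 1}"

definition hedge_eta :: real where
  "hedge_eta = 1 / 8"

definition hedge_beta :: real where
  "hedge_beta = 1 / 32"

text \<open>
  In the next four definitions \<open>L\<close> stands for the cumulative loss vector \<open>L\<^sub>t\<^sub>-\<^sub>1\<close> and \<open>b\<close> for
  the previous loss \<open>c\<^sub>t\<^sub>-\<^sub>1\<close>: a round depends on the past only through these two vectors.
\<close>

definition hedge_weight :: "real ^ 'd::finite \<Rightarrow> real ^ 'd \<Rightarrow> real \<Rightarrow> 'd \<Rightarrow> real" where
  "hedge_weight L b \<theta> i = exp (- hedge_eta * L $ i - hedge_beta * (b $ i - \<theta>)\<^sup>2)"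

text \<open>The description is proper for losses in the unit cube, see \<open>hedge_theta_ex1\<close> below.\<close>

definition hedge_theta :: "real ^ 'd::finite \<Rightarrow> real ^ 'd \<Rightarrow> real" where
  "hedge_theta L b =
     (THE \<theta>. is_arg_max (\<lambda>\<theta>. ln (\<Sum>i\<in>UNIV. hedge_weight L b \<theta> i)) (\<lambda>_. True) \<theta>)"

definition hedge_prob :: "real ^ 'd::finite \<Rightarrow> real ^ 'd \<Rightarrow> real ^ 'd" where
  "hedge_prob L b =
     (\<chi> i. hedge_weight L b (hedge_theta L b) i
            / (\<Sum>j\<in>UNIV. hedge_weight L b (hedge_theta L b) j))"

definition hedge_play :: "real ^ 'd::finite \<Rightarrow> real ^ 'd \<Rightarrow> real ^ 'd" where
  "hedge_play L b = (\<chi> i. hedge_prob L b $ i * (1 - (b $ i - hedge_theta L b) / 2))"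

primrec cum_loss :: "(nat \<Rightarrow> real ^ 'd::finite) \<Rightarrow> nat \<Rightarrow> real ^ 'd" where
  "cum_loss c 0 = 0"
| "cum_loss c (Suc t) = cum_loss c t + c t + c (Suc t)"

text \<open>
  The trajectory \<open>(c, x)\<close> of an interaction of the algorithm with an environment over \<open>T\<close> rounds.
  Nothing is said about how the losses arise, so \<open>c t\<close> may depend on \<open>x 1, \<dots>, x t\<close>.
\<close>

definition alt_hedge_run ::
    "nat \<Rightarrow> (nat \<Rightarrow> real ^ 'd::finite) \<Rightarrow> (nat \<Rightarrow> real ^ 'd) \<Rightarrow> bool" where
  "alt_hedge_run T c x \<longleftrightarrow>
     (\<forall>t\<in>{1..T}. x t = hedge_play (cum_loss c (t - 1)) (c (t - 1)))"

text \<open>The infimum is a minimum, see \<open>alt_loss_min_attained\<close> below.\<close>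

definition alt_regret ::
    "nat \<Rightarrow> (nat \<Rightarrow> real ^ 'd::finite) \<Rightarrow> (nat \<Rightarrow> real ^ 'd) \<Rightarrow> real" where
  "alt_regret T c x =
     (\<Sum>t=1..T. (c (t - 1) + c t) \<bullet> x t)
     - (INF y\<in>prob_simplex. \<Sum>t=1..T. (c (t - 1) + c t) \<bullet> y)"


lemma compact_prob_simplex: "compact (prob_simplex :: (real ^ 'd::finite) set)"
proof -
  have "closed (prob_simplex :: (real ^ 'd) set)"
    unfolding prob_simplex_def
    by (intro closed_Collect_conj closed_Collect_all closed_Collect_le closed_Collect_eq
        continuous_intros)
  moreover have "bounded (prob_simplex :: (real ^ 'd) set)"
  proof (rule boundedI)
    fix x :: "real ^ 'd"
    assume "x \<in> prob_simplex"
    then show "norm x \<le> 1"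
      using norm_le_l1_cart[of x] by (simp add: prob_simplex_def)
  qed
  ultimately show ?thesis
    by (simp add: compact_eq_bounded_closed)
qed

lemma prob_simplex_nonempty: "(prob_simplex :: (real ^ 'd::finite) set) \<noteq> {}"
proof -
  have "axis i 1 \<in> (prob_simplex :: (real ^ 'd) set)" for i
    by (simp add: prob_simplex_def axis_def)
  then show ?thesis by blast
qed

lemma alt_loss_min_attained:
  fixes c :: "nat \<Rightarrow> real ^ 'd::finite"
  shows "\<exists>z\<in>prob_simplex.
           (\<Sum>t=1..T. (c (t - 1) + c t) \<bullet> z)
             = (INF y\<in>prob_simplex. \<Sum>t=1..T. (c (t - 1) + c t) \<bullet> y)
         \<and> (\<forall>y\<in>prob_simplex.
              (\<Sum>t=1..T. (c (t - 1) + c t) \<bullet> z) \<le> (\<Sum>t=1..T. (c (t - 1) + c t) \<bullet> y))"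
proof -
  let ?f = "\<lambda>y. \<Sum>t=1..T. (c (t - 1) + c t) \<bullet> y"
  have "continuous_on (prob_simplex :: (real ^ 'd) set) ?f"
    by (intro continuous_intros)
  then obtain z where z: "z \<in> prob_simplex" "\<forall>y\<in>prob_simplex. ?f z \<le> ?f y"
    using continuous_attains_inf[OF compact_prob_simplex prob_simplex_nonempty] by blast
  then have "?f z = (INF y\<in>prob_simplex. ?f y)"
    by (intro cInf_eq_minimum[symmetric]) auto
  with z show ?thesis by blast
qed

lemma cosh_le_exp_half_square: "cosh x \<le> exp (x\<^sup>2 / 2)" for x :: real
proof -
  have *: "cosh x \<le> exp (x\<^sup>2 / 2)" if "x \<ge> 0" for x :: real
  proof -
    define g where "g = (\<lambda>u::real. u\<^sup>2 / 2 - ln (cosh u))"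
    have "g 0 \<le> g x"
    proof (rule DERIV_nonneg_imp_nondecreasing[OF that])
      fix u :: real
      assume "0 \<le> u" "u \<le> x"
      define k where "k = (\<lambda>u::real. u * cosh u - sinh u)"
      have "k 0 \<le> k u"
      proof (rule DERIV_nonneg_imp_nondecreasing[OF \<open>0 \<le> u\<close>])
        fix v :: real
        assume "0 \<le> v"
        have "(k has_real_derivative v * sinh v) (at v)"
          unfolding k_def by (auto intro!: derivative_eq_intros)
        moreover have "v * sinh v \<ge> 0"
          using \<open>0 \<le> v\<close> by simp
        ultimately show "\<exists>y. (k has_real_derivative y) (at v) \<and> 0 \<le> y" by blast
      qed
      then have "u - sinh u / cosh u \<ge> 0"
        by (simp add: k_def field_simps)
      moreover have "(g has_real_derivative u - sinh u / cosh u) (at u)"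
        unfolding g_def by (auto intro!: derivative_eq_intros simp: field_simps)
      ultimately show "\<exists>y. (g has_real_derivative y) (at u) \<and> 0 \<le> y" by blast
    qed
    then have "ln (cosh x) \<le> x\<^sup>2 / 2"
      by (simp add: g_def)
    then show ?thesis
      by (metis cosh_real_pos exp_le_cancel_iff exp_ln)
  qed
  show ?thesis
    using *[of x] *[of "- x"] by (cases "x \<ge> 0") auto
qed

lemma exp_neg_square_midpoint:
  fixes u v :: real
  assumes "u \<noteq> v" "\<bar>u\<bar> \<le> 2" "\<bar>v\<bar> \<le> 2"
  shows "exp (- (u\<^sup>2 / 32)) + exp (- (v\<^sup>2 / 32)) < 2 * exp (- (((u + v) / 2)\<^sup>2 / 32))"
proof -
  define m h where "m = (u + v) / 2" and "h = (u - v) / 2"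
  have uv: "u = m + h" "v = m - h" by (auto simp: m_def h_def field_simps)
  have "h \<noteq> 0" "\<bar>m\<bar> \<le> 2" using assms by (auto simp: m_def h_def)
  have "m\<^sup>2 \<le> 4" using \<open>\<bar>m\<bar> \<le> 2\<close> abs_le_square_iff[of m 2] by simp
  then have "m\<^sup>2 * h\<^sup>2 \<le> 4 * h\<^sup>2" by (intro mult_right_mono) auto
  then have "(m * h / 16)\<^sup>2 / 2 < h\<^sup>2 / 32"
    using \<open>h \<noteq> 0\<close> zero_less_power2[of h] by (simp add: power_mult_distrib power_divide)
  then have cosh: "cosh (m * h / 16) < exp (h\<^sup>2 / 32)"
    using cosh_le_exp_half_square[of "m * h / 16"] by (meson exp_less_cancel_iff le_less_trans)
  have "- (u\<^sup>2 / 32) = - (m\<^sup>2 / 32) + - (h\<^sup>2 / 32) + - (m * h / 16)"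
       "- (v\<^sup>2 / 32) = - (m\<^sup>2 / 32) + - (h\<^sup>2 / 32) + m * h / 16"
    unfolding uv by (simp_all add: power2_sum power2_diff field_simps)
  then have "exp (- (u\<^sup>2 / 32)) + exp (- (v\<^sup>2 / 32))
      = exp (- (m\<^sup>2 / 32)) * exp (- (h\<^sup>2 / 32)) * (exp (m * h / 16) + exp (- (m * h / 16)))"
    by (simp only: exp_add distrib_left add.commute mult.commute mult.left_commute)
  also have "\<dots> = exp (- (m\<^sup>2 / 32)) * exp (- (h\<^sup>2 / 32)) * (2 * cosh (m * h / 16))"
    by (simp add: cosh_field_def exp_minus)
  also have "\<dots> < exp (- (m\<^sup>2 / 32)) * exp (- (h\<^sup>2 / 32)) * (2 * exp (h\<^sup>2 / 32))"
    using cosh by (intro mult_strict_left_mono) auto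
  also have "\<dots> = 2 * exp (- (m\<^sup>2 / 32))"
    by (simp add: exp_add[symmetric] exp_minus)
  finally show ?thesis by (simp add: m_def)
qed

lemma hedge_theta_ex1:
  fixes L b :: "real ^ 'd::finite"
  assumes b: "\<forall>i. b $ i \<in> {-1..1}"
  shows "\<exists>!\<theta>. is_arg_max (\<lambda>\<theta>. ln (\<Sum>i\<in>UNIV. hedge_weight L b \<theta> i)) (\<lambda>_. True) \<theta>"
proof -
  define H where "H = (\<lambda>\<theta>. \<Sum>i\<in>UNIV. hedge_weight L b \<theta> i)"
  have H_pos: "H \<theta> > 0" for \<theta>
    unfolding H_def hedge_weight_def by (intro sum_pos) auto
  have arg_max_iff:
    "is_arg_max (\<lambda>\<theta>. ln (\<Sum>i\<in>UNIV. hedge_weight L b \<theta> i)) (\<lambda>_. True) \<theta>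
      \<longleftrightarrow> (\<forall>\<theta>'. H \<theta>' \<le> H \<theta>)" for \<theta>
    unfolding is_arg_max_def H_def[THEN fun_cong, symmetric] by (simp add: H_pos not_less)
  have mono: "H \<theta> < H \<theta>'"
    if "\<And>i. \<bar>b $ i - \<theta>'\<bar> < \<bar>b $ i - \<theta>\<bar>" for \<theta> \<theta>'
    unfolding H_def hedge_weight_def hedge_beta_def
    using that by (intro sum_strict_mono) (auto simp: abs_le_square_iff[symmetric] not_le[symmetric])
  have right: "H \<theta> < H 1" if "\<theta> > 1" for \<theta>
  proof (rule mono)
    fix i
    show "\<bar>b $ i - 1\<bar> < \<bar>b $ i - \<theta>\<bar>" using b[rule_format, of i] that by auto
  qed
  have left: "H \<theta> < H (- 1)" if "\<theta> < - 1" for \<theta>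
  proof (rule mono)
    fix i
    show "\<bar>b $ i - (- 1)\<bar> < \<bar>b $ i - \<theta>\<bar>" using b[rule_format, of i] that by auto
  qed
  have range: "\<theta> \<in> {-1..1}" if "\<forall>\<theta>'. H \<theta>' \<le> H \<theta>" for \<theta>
    using that left[of \<theta>] right[of \<theta>] by (metis atLeastAtMost_iff not_le)
  have "continuous_on {-1..1} H"
    unfolding H_def hedge_weight_def by (intro continuous_intros)
  then obtain \<theta>0 where \<theta>0: "\<theta>0 \<in> {-1..1}" "\<forall>\<theta>\<in>{-1..1}. H \<theta> \<le> H \<theta>0"
    using continuous_attains_sup[of "{-1..1::real}" H] by auto
  have max: "H \<theta> \<le> H \<theta>0" for \<theta>
  proof -
    consider "\<theta> < -1" | "\<theta> \<in> {-1..1}" | "\<theta> > 1" by fastforce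
    then show ?thesis
    proof cases
      case 1
      then show ?thesis using left[of \<theta>] \<theta>0(2)[rule_format, of "-1"] by auto
    next
      case 2
      then show ?thesis using \<theta>0 by blast
    next
      case 3
      then show ?thesis using right[of \<theta>] \<theta>0(2)[rule_format, of 1] by auto
    qed
  qed
  have unique: "\<theta> = \<theta>0" if \<theta>: "\<forall>\<theta>'. H \<theta>' \<le> H \<theta>" for \<theta>
  proof (rule ccontr)
    assume "\<theta> \<noteq> \<theta>0"
    have "H \<theta> + H \<theta>0 < 2 * H ((\<theta> + \<theta>0) / 2)"
      unfolding H_def sum_distrib_left sum.distrib[symmetric]
    proof (rule sum_strict_mono)
      fix i :: 'd
      have mid: "((b $ i - \<theta>) + (b $ i - \<theta>0)) / 2 = b $ i - (\<theta> + \<theta>0) / 2"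
        by (simp add: field_simps)
      have "exp (- ((b $ i - \<theta>)\<^sup>2 / 32)) + exp (- ((b $ i - \<theta>0)\<^sup>2 / 32))
          < 2 * exp (- ((b $ i - (\<theta> + \<theta>0) / 2)\<^sup>2 / 32))"
        unfolding mid[symmetric]
        using \<open>\<theta> \<noteq> \<theta>0\<close> range[OF \<theta>] \<theta>0(1) b[rule_format, of i]
        by (intro exp_neg_square_midpoint) auto
      then have "exp (- hedge_eta * L $ i)
            * (exp (- ((b $ i - \<theta>)\<^sup>2 / 32)) + exp (- ((b $ i - \<theta>0)\<^sup>2 / 32)))
          < exp (- hedge_eta * L $ i) * (2 * exp (- ((b $ i - (\<theta> + \<theta>0) / 2)\<^sup>2 / 32)))"
        by (intro mult_strict_left_mono) auto
      moreover have "hedge_weight L b \<phi> i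
          = exp (- hedge_eta * L $ i) * exp (- ((b $ i - \<phi>)\<^sup>2 / 32))" for \<phi>
        by (simp add: hedge_weight_def hedge_beta_def flip: exp_add)
      ultimately show "hedge_weight L b \<theta> i + hedge_weight L b \<theta>0 i
          < 2 * hedge_weight L b ((\<theta> + \<theta>0) / 2) i"
        by (simp add: algebra_simps)
    qed auto
    moreover have "H \<theta> = H \<theta>0" using \<theta> max by (meson order_antisym)
    ultimately show False using max[of "(\<theta> + \<theta>0) / 2"] by simp
  qed
  show ?thesis
    unfolding arg_max_iff using max unique by blast
qed

end

theory Submission
  imports Defs
begin

text \<open>
  The potential is \<open>\<Phi> L b = max\<^sub>\<theta> (\<Sum>i. exp (- \<eta> L\<^sub>i - \<beta> (b\<^sub>i - \<theta>)\<^sup>2))\<close>.  It equals \<open>d\<close> at the start and, taking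
  \<open>\<theta> = b\<^sub>i\<close>, it is at least \<open>exp (- \<eta> L\<^sub>i)\<close> for every \<open>i\<close>, so the bound \<open>ln d / \<eta>\<close> follows once round
  \<open>t\<close> is known to multiply it by at most \<open>exp (- \<eta> (c\<^sub>t\<^sub>-\<^sub>1 + c\<^sub>t) \<bullet> x\<^sub>t)\<close>.
  Put \<open>u = c\<^sub>t\<^sub>-\<^sub>1 - \<theta>\<^sub>t\<close> and \<open>v = c\<^sub>t - \<theta>\<^sub>t\<^sub>+\<^sub>1\<close>.  Optimality of \<open>\<theta>\<^sub>t\<close> means that \<open>u\<close> has mean zero under \<open>p\<^sub>t\<close>;
  hence \<open>x\<^sub>t\<close> is a probability vector, the shifts by \<open>\<theta>\<^sub>t\<close> and \<open>\<theta>\<^sub>t\<^sub>+\<^sub>1\<close> cancel, and the claim becomes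
  \<open>E (exp X) \<le> exp (E (X + \<beta> (u + v)\<^sup>2))\<close> with \<open>X = - \<eta> (u + v) - \<beta> (v\<^sup>2 - u\<^sup>2)\<close>, because \<open>\<eta> = 4 \<beta>\<close>.
  As \<open>\<bar>u\<bar>, \<bar>v\<bar> \<le> 2\<close>, even the pointwise inequality \<open>exp X \<le> 1 + X + \<beta> (u + v)\<^sup>2\<close> holds.
\<close>

section \<open>Scalar bounds on the exponential\<close>

lemma exp_le_quadratic_nonpos:
  fixes x :: real
  assumes "x \<le> 0"
  shows "exp x \<le> 1 + x + x\<^sup>2 / 2"
proof -
  define h where "h = (\<lambda>x::real. (1 + x + x\<^sup>2 / 2) * exp (- x))"
  have "h 0 \<le> h x"
  proof (rule DERIV_nonpos_imp_nonincreasing[OF assms])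
    fix y :: real
    have "(h has_real_derivative - (y\<^sup>2 / 2 * exp (- y))) (at y)"
      unfolding h_def
      by (auto intro!: derivative_eq_intros simp: field_simps power2_eq_square)
    then show "\<exists>z. (h has_real_derivative z) (at y) \<and> z \<le> 0" by force
  qed
  then show ?thesis by (simp add: h_def exp_minus field_simps)
qed

text \<open>With cubic coefficient 1/4 instead of Taylor's 1/6, the polynomial times
  \<open>exp (- x)\<close> has derivative \<open>x\<^sup>2 * (1 - x) / 4 * exp (- x)\<close>,
  nonnegative up to 1.\<close>

lemma exp_le_cubic:
  fixes x :: real
  assumes "0 \<le> x" "x \<le> 1"
  shows "exp x \<le> 1 + x + x\<^sup>2 / 2 + x ^ 3 / 4"
proof -
  define h where "h = (\<lambda>x::real. (1 + x + x\<^sup>2 / 2 + x ^ 3 / 4) * exp (- x))"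
  have "h 0 \<le> h x"
  proof (rule DERIV_nonneg_imp_nondecreasing[OF assms(1)])
    fix y :: real
    assume "0 \<le> y" "y \<le> x"
    have "(h has_real_derivative y\<^sup>2 * (1 - y) / 4 * exp (- y)) (at y)"
      unfolding h_def
      by (auto intro!: derivative_eq_intros simp: field_simps power2_eq_square power3_eq_cube)
    moreover have "y\<^sup>2 * (1 - y) / 4 * exp (- y) \<ge> 0"
      using \<open>y \<le> x\<close> assms by simp
    ultimately show "\<exists>z. (h has_real_derivative z) (at y) \<and> 0 \<le> z" by blast
  qed
  then show ?thesis by (simp add: h_def exp_minus field_simps)
qed

text \<open>For the exponent X on the left, the right side is
  \<open>1 + X + (u + v)\<^sup>2 / 32\<close>, so only the remainder of \<open>exp\<close> beyond
  first order has to be bounded.\<close>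

lemma exp_loss_le:
  fixes u v :: real
  assumes "\<bar>u\<bar> \<le> 2" "\<bar>v\<bar> \<le> 2"
  shows "exp (- (u + v) / 8 - (v\<^sup>2 - u\<^sup>2) / 32) \<le> 1 - (u + v) / 8 * (1 - u / 2)"
proof -
  define s X where "s = \<bar>u + v\<bar>" and "X = - (u + v) / 8 - (v\<^sup>2 - u\<^sup>2) / 32"
  \<comment> \<open>The last bound is \<open>\<bar>u + v\<bar> + \<bar>v - u\<bar> = 2 * max
    \<bar>u\<bar> \<bar>v\<bar>\<close>: a large sum forces a small difference.\<close>
  have s: "0 \<le> s" "s \<le> 4" "\<bar>v - u\<bar> \<le> 4 - s" using assms by (auto simp: s_def)
  have X_eq: "X = - ((u + v) * (4 + (v - u)) / 32)"
    by (simp add: X_def power2_eq_square field_simps)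
  have "\<bar>X\<bar> = s * \<bar>4 + (v - u)\<bar> / 32"
    unfolding X_eq s_def by (simp add: abs_mult)
  also have "\<dots> \<le> s * (8 - s) / 32"
    using s by (intro divide_right_mono mult_left_mono) auto
  finally have X_le: "\<bar>X\<bar> \<le> s * (8 - s) / 32" .
  have "X\<^sup>2 \<le> (s * (8 - s) / 32)\<^sup>2"
    using X_le by (metis abs_ge_zero power2_abs power_mono)
  then have X2: "X\<^sup>2 / 2 \<le> s\<^sup>2 / 32 * (1 - s / 8)\<^sup>2"
    by (simp add: power2_eq_square field_simps)
  have "exp X \<le> 1 + X + s\<^sup>2 / 32"
  proof (cases "X \<le> 0")
    case True
    have "s\<^sup>2 / 32 * (1 - s / 8)\<^sup>2 \<le> s\<^sup>2 / 32 * 1"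
      using s by (intro mult_left_mono power_le_one) auto
    with X2 exp_le_quadratic_nonpos[OF True] show ?thesis by linarith
  next
    case False
    have "s * (8 - s) \<le> s * 8" using s by (intro mult_left_mono) auto
    with X_le have X: "0 \<le> X" "X \<le> s / 4" using False by linarith+
    have "X\<^sup>2 / 2 + X ^ 3 / 4 = X\<^sup>2 / 2 * (1 + X / 2)"
      by (simp add: power2_eq_square power3_eq_cube field_simps)
    also have "\<dots> \<le> s\<^sup>2 / 32 * (1 - s / 8)\<^sup>2 * (1 + s / 8)"
      using X2 X by (intro mult_mono) auto
    \<comment> \<open>One of the two factors \<open>1 - s / 8\<close> absorbs the cubic correction
      \<open>1 + s / 8\<close>.\<close>
    also have "\<dots> = s\<^sup>2 / 32 * ((1 - s / 8) * (1 - (s / 8)\<^sup>2))"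
      by (simp add: power2_eq_square field_simps)
    also have "\<dots> \<le> s\<^sup>2 / 32 * 1"
      using s by (intro mult_left_mono mult_le_one) (auto intro!: power_le_one)
    finally show ?thesis using exp_le_cubic[of X] X s by linarith
  qed
  also have "1 + X + s\<^sup>2 / 32 = 1 - (u + v) / 8 * (1 - u / 2)"
    by (simp add: s_def X_def power2_eq_square field_simps)
  finally show ?thesis by (simp add: X_def)
qed

section \<open>The potential and the optimality of \<open>hedge_theta\<close>\<close>

definition hedge_potential :: "real ^ 'd::finite \<Rightarrow> real ^ 'd \<Rightarrow> real" where
  "hedge_potential L b = (\<Sum>i\<in>UNIV. hedge_weight L b (hedge_theta L b) i)"

lemma hedge_weight_pos: "hedge_weight L b \<theta> i > 0"
  by (simp add: hedge_weight_def)

lemma sum_hedge_weight_pos: "(\<Sum>i\<in>UNIV. hedge_weight L b \<theta> i) > 0"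
  by (intro sum_pos) (auto simp: hedge_weight_pos)

lemma hedge_potential_pos: "hedge_potential L b > 0"
  by (simp add: hedge_potential_def sum_hedge_weight_pos)

text \<open>For \<open>b\<close> in the unit cube the maximizer exists and is unique, so the
  description in \<open>hedge_theta\<close> denotes it.\<close>

lemma sum_hedge_weight_le_potential:
  fixes L b :: "real ^ 'd::finite"
  assumes "\<forall>i. b $ i \<in> {-1..1}"
  shows "(\<Sum>i\<in>UNIV. hedge_weight L b \<theta> i) \<le> hedge_potential L b"
proof -
  have "is_arg_max (\<lambda>\<theta>. ln (\<Sum>i\<in>UNIV. hedge_weight L b \<theta> i)) (\<lambda>_. True) (hedge_theta L b)"
    unfolding hedge_theta_def by (rule theI'[OF hedge_theta_ex1[OF assms]])
  then show ?thesis
    by (simp add: is_arg_max_def hedge_potential_def sum_hedge_weight_pos not_less)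
qed

lemma exp_le_hedge_potential:
  fixes L b :: "real ^ 'd::finite"
  assumes "\<forall>i. b $ i \<in> {-1..1}"
  shows "exp (- hedge_eta * L $ i) \<le> hedge_potential L b"
proof -
  have "exp (- hedge_eta * L $ i) = hedge_weight L b (b $ i) i"
    by (simp add: hedge_weight_def)
  also have "\<dots> \<le> (\<Sum>j\<in>UNIV. hedge_weight L b (b $ i) j)"
    by (intro member_le_sum) (auto simp: hedge_weight_pos less_imp_le)
  finally show ?thesis using sum_hedge_weight_le_potential[OF assms] by (meson order_trans)
qed

lemma hedge_potential_0_le:
  "hedge_potential 0 (0 :: real ^ 'd::finite) \<le> real CARD('d)"
proof -
  have "hedge_potential 0 (0 :: real ^ 'd) \<le> (\<Sum>i\<in>(UNIV :: 'd set). 1)"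
    unfolding hedge_potential_def
    by (intro sum_mono) (simp add: hedge_weight_def hedge_beta_def)
  then show ?thesis by simp
qed

lemma hedge_prob_nonneg: "0 \<le> hedge_prob L b $ i"
  by (simp add: hedge_prob_def hedge_weight_pos sum_hedge_weight_pos less_imp_le)

lemma sum_hedge_prob: "(\<Sum>i\<in>UNIV. hedge_prob L b $ i) = 1"
  using sum_hedge_weight_pos[of L b "hedge_theta L b"]
  by (simp add: hedge_prob_def flip: sum_divide_distrib)

lemma hedge_theta_mean:
  fixes L b :: "real ^ 'd::finite"
  assumes "\<forall>i. b $ i \<in> {-1..1}"
  shows "(\<Sum>i\<in>UNIV. hedge_prob L b $ i * (b $ i - hedge_theta L b)) = 0"
proof -
  let ?H = "\<lambda>\<theta>. \<Sum>i\<in>UNIV. hedge_weight L b \<theta> i"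
  let ?\<theta> = "hedge_theta L b"
  have "(?H has_real_derivative
          (\<Sum>i\<in>UNIV. hedge_weight L b ?\<theta> i * (2 * hedge_beta * (b $ i - ?\<theta>)))) (at ?\<theta>)"
    unfolding hedge_weight_def
    by (auto intro!: derivative_eq_intros sum.cong simp: algebra_simps)
  \<comment> \<open>The maximum is global, so the radius 1 is arbitrary.\<close>
  then have "(\<Sum>i\<in>UNIV. hedge_weight L b ?\<theta> i * (2 * hedge_beta * (b $ i - ?\<theta>))) = 0"
    using sum_hedge_weight_le_potential[OF assms, of L]
    by (intro DERIV_local_max[where d = 1]) (auto simp: hedge_potential_def)
  moreover have "(\<Sum>i\<in>UNIV. hedge_weight L b ?\<theta> i * (2 * hedge_beta * (b $ i - ?\<theta>)))
      = 2 * hedge_beta * (\<Sum>i\<in>UNIV. hedge_weight L b ?\<theta> i * (b $ i - ?\<theta>))"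
    unfolding sum_distrib_left by (intro sum.cong refl) simp
  ultimately have "(\<Sum>i\<in>UNIV. hedge_weight L b ?\<theta> i * (b $ i - ?\<theta>)) = 0"
    by (simp add: hedge_beta_def)
  then show ?thesis
    by (simp add: hedge_prob_def flip: sum_divide_distrib)
qed

text \<open>By the mean-zero condition, \<open>hedge_theta L b\<close> is a weighted average of the
  entries of \<open>b\<close>.\<close>

lemma hedge_theta_bounds:
  fixes L b :: "real ^ 'd::finite"
  assumes b: "\<forall>i. b $ i \<in> {-1..1}"
  shows "hedge_theta L b \<in> {-1..1}"
proof -
  let ?p = "hedge_prob L b"
  have "hedge_theta L b = (\<Sum>i\<in>UNIV. ?p $ i * b $ i)"
    using hedge_theta_mean[OF b, of L] sum_hedge_prob[of L b]
    by (simp add: right_diff_distrib sum_subtractf flip: sum_distrib_right)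
  moreover have "(\<Sum>i\<in>UNIV. ?p $ i * b $ i) \<le> (\<Sum>i\<in>UNIV. ?p $ i * 1)"
    using b hedge_prob_nonneg by (intro sum_mono mult_left_mono) auto
  moreover have "(\<Sum>i\<in>UNIV. ?p $ i * (- 1)) \<le> (\<Sum>i\<in>UNIV. ?p $ i * b $ i)"
    using b hedge_prob_nonneg by (intro sum_mono mult_left_mono) auto
  ultimately show ?thesis
    by (simp add: sum_hedge_prob sum_negf)
qed

lemma sum_hedge_play:
  fixes L b :: "real ^ 'd::finite"
  assumes "\<forall>i. b $ i \<in> {-1..1}"
  shows "(\<Sum>i\<in>UNIV. hedge_play L b $ i) = 1"
proof -
  have "(\<Sum>i\<in>UNIV. hedge_play L b $ i)
      = (\<Sum>i\<in>UNIV. hedge_prob L b $ i) - (\<Sum>i\<in>UNIV. hedge_prob L b $ i * (b $ i - hedge_theta L b)) / 2"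
    by (simp add: hedge_play_def sum_divide_distrib right_diff_distrib flip: sum_subtractf)
  then show ?thesis by (simp add: sum_hedge_prob hedge_theta_mean[OF assms])
qed

lemma hedge_play_in_simplex:
  fixes L b :: "real ^ 'd::finite"
  assumes b: "\<forall>i. b $ i \<in> {-1..1}"
  shows "hedge_play L b \<in> prob_simplex"
proof -
  \<comment> \<open>Both \<open>b $ i\<close> and \<open>hedge_theta L b\<close> lie in [-1,1], so
    the correction factor is at least 0.\<close>
  have "0 \<le> hedge_play L b $ i" for i
    using b[rule_format, of i] hedge_theta_bounds[OF b, of L] hedge_prob_nonneg[of L b i]
    by (simp add: hedge_play_def)
  then show ?thesis by (simp add: prob_simplex_def sum_hedge_play[OF b])
qed

section \<open>One round of the potential, then the regret bound\<close>

lemma hedge_potential_step: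
  fixes L b c :: "real ^ 'd::finite"
  assumes b: "\<forall>i. b $ i \<in> {-1..1}" and c: "\<forall>i. c $ i \<in> {-1..1}"
  shows "hedge_potential (L + b + c) c
      \<le> hedge_potential L b * exp (- hedge_eta * ((b + c) \<bullet> hedge_play L b))"
proof -
  define \<theta> \<theta>' where "\<theta> = hedge_theta L b" and "\<theta>' = hedge_theta (L + b + c) c"
  define p x where "p = hedge_prob L b" and "x = hedge_play L b"
  define u v where "u i = b $ i - \<theta>" and "v i = c $ i - \<theta>'" for i
  \<comment> \<open>The shifts times \<eta>:
    \<open>(b $ i + c $ i) / 8 = (u i + v i) / 8 + S\<close>.\<close>
  define S where "S = (\<theta> + \<theta>') / 8"
  have \<theta>: "\<theta> \<in> {-1..1}" "\<theta>' \<in> {-1..1}"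
    using hedge_theta_bounds b c by (auto simp: \<theta>_def \<theta>'_def)
  have uv: "\<bar>u i\<bar> \<le> 2" "\<bar>v i\<bar> \<le> 2" for i
    using b[rule_format, of i] c[rule_format, of i] \<theta> by (auto simp: u_def v_def)
  have w: "hedge_weight L b \<theta> i = hedge_potential L b * p $ i" for i
    using sum_hedge_weight_pos[of L b \<theta>]
    by (simp add: hedge_potential_def p_def hedge_prob_def \<theta>_def)
  have w': "hedge_weight (L + b + c) c \<theta>' i = hedge_potential L b * exp (- S)
      * (p $ i * exp (- (u i + v i) / 8 - ((v i)\<^sup>2 - (u i)\<^sup>2) / 32))" for i
  proof -
    have "hedge_weight (L + b + c) c \<theta>' i
        = exp (- S) * (hedge_weight L b \<theta> i * exp (- (u i + v i) / 8 - ((v i)\<^sup>2 - (u i)\<^sup>2) / 32))"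
      unfolding hedge_weight_def exp_add[symmetric]
      by (simp add: hedge_eta_def hedge_beta_def u_def v_def S_def field_simps)
    then show ?thesis by (simp add: w)
  qed
  have sum_x: "(\<Sum>i\<in>UNIV. x $ i) = 1" by (simp add: x_def sum_hedge_play[OF b])
  have "(\<Sum>i\<in>UNIV. p $ i * exp (- (u i + v i) / 8 - ((v i)\<^sup>2 - (u i)\<^sup>2) / 32))
      \<le> (\<Sum>i\<in>UNIV. p $ i * (1 - (u i + v i) / 8 * (1 - u i / 2)))"
    using exp_loss_le[OF uv] by (intro sum_mono mult_left_mono) (auto simp: p_def hedge_prob_nonneg)
  \<comment> \<open>Here \<open>p $ i * (1 - u i / 2)\<close> is \<open>x $ i\<close>; since
    \<open>x\<close> sums to 1, the shifts contribute exactly S, cancelled later by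
    \<open>exp (- S)\<close>.\<close>
  also have "\<dots> = (\<Sum>i\<in>UNIV. p $ i - (b $ i + c $ i) * x $ i / 8 + S * x $ i)"
    by (intro sum.cong refl)
       (simp add: x_def hedge_play_def p_def[symmetric] \<theta>_def[symmetric] u_def v_def S_def field_simps)
  also have "\<dots> = 1 + (S - ((b + c) \<bullet> x) / 8)"
    using sum_x by (simp add: sum.distrib sum_subtractf p_def sum_hedge_prob inner_vec_def
      flip: sum_divide_distrib sum_distrib_left)
  also have "\<dots> \<le> exp (S - ((b + c) \<bullet> x) / 8)"
    by (rule exp_ge_add_one_self)
  finally have "hedge_potential L b * exp (- S)
        * (\<Sum>i\<in>UNIV. p $ i * exp (- (u i + v i) / 8 - ((v i)\<^sup>2 - (u i)\<^sup>2) / 32))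
      \<le> hedge_potential L b * exp (- S) * exp (S - ((b + c) \<bullet> x) / 8)"
    using hedge_potential_pos[of L b] by (intro mult_left_mono) auto
  also have "\<dots> = hedge_potential L b * exp (- hedge_eta * ((b + c) \<bullet> x))"
    by (simp add: hedge_eta_def mult.assoc flip: exp_add)
  finally show ?thesis
    unfolding hedge_potential_def[of "L + b + c"] \<theta>'_def[symmetric] w' sum_distrib_left[symmetric]
    by (simp add: x_def)
qed

lemma cum_loss_eq_sum: "cum_loss c T = (\<Sum>t=1..T. c (t - 1) + c t)"
  by (induction T) (auto simp: add.assoc)

theorem theorem1:
  fixes T :: nat
    and c x :: "nat \<Rightarrow> real ^ 'd::finite"
  assumes "T \<ge> 1"
    and "c 0 = 0"
    and "\<forall>t\<in>{1..T}. \<forall>i. c t $ i \<in> {-1..1}"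
    and "alt_hedge_run T c x"
  shows "(\<forall>t\<in>{1..T}. x t \<in> prob_simplex) \<and> alt_regret T c x \<le> 8 * ln (real CARD('d))"
proof
  \<comment> \<open>Index 0 is included, since round 1 uses \<open>c 0 = 0\<close> as its previous
    loss.\<close>
  have c: "\<forall>i. c t $ i \<in> {-1..1}" if "t \<le> T" for t
    using assms(2,3) that by (cases "t = 0") auto
  have x: "x t = hedge_play (cum_loss c (t - 1)) (c (t - 1))" if "t \<in> {1..T}" for t
    using assms(4) that by (auto simp: alt_hedge_run_def)
  show "\<forall>t\<in>{1..T}. x t \<in> prob_simplex"
    using c x by (auto intro!: hedge_play_in_simplex)
  define \<Phi> where "\<Phi> = hedge_potential (cum_loss c T) (c T)"
  define A where "A n = (\<Sum>t=1..n. (c (t - 1) + c t) \<bullet> x t)" for n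
  have "hedge_potential (cum_loss c n) (c n) \<le> real CARD('d) * exp (- hedge_eta * A n)"
    if "n \<le> T" for n
    using that
  proof (induction n)
    case 0
    then show ?case using hedge_potential_0_le assms(2) by (simp add: A_def)
  next
    case (Suc n)
    have "hedge_potential (cum_loss c (Suc n)) (c (Suc n))
        \<le> hedge_potential (cum_loss c n) (c n)
          * exp (- hedge_eta * ((c n + c (Suc n)) \<bullet> x (Suc n)))"
      using hedge_potential_step[OF c[of n] c[of "Suc n"]] x[of "Suc n"] Suc.prems by simp
    also have "\<dots> \<le> real CARD('d) * exp (- hedge_eta * A n)
          * exp (- hedge_eta * ((c n + c (Suc n)) \<bullet> x (Suc n)))"
      using Suc by (intro mult_right_mono) auto
    also have "\<dots> = real CARD('d) * exp (- hedge_eta * A (Suc n))"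
      by (simp add: A_def algebra_simps flip: exp_add)
    finally show ?case .
  qed
  then have "\<Phi> \<le> real CARD('d) * exp (- hedge_eta * A T)" by (simp add: \<Phi>_def)
  then have "ln \<Phi> \<le> ln (real CARD('d) * exp (- hedge_eta * A T))"
    by (simp add: \<Phi>_def hedge_potential_pos)
  then have ln_\<Phi>: "8 * ln \<Phi> \<le> 8 * ln (real CARD('d)) - A T"
    by (simp add: ln_mult hedge_eta_def)
  \<comment> \<open>A lower bound on every coordinate carries over to each convex combination of
    them, in particular to the comparator \<open>z\<close>.\<close>
  have coord: "- 8 * ln \<Phi> \<le> cum_loss c T $ i" for i
  proof -
    have "exp (- hedge_eta * cum_loss c T $ i) \<le> \<Phi>"
      unfolding \<Phi>_def by (rule exp_le_hedge_potential[OF c[OF order_refl]])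
    then have "- hedge_eta * cum_loss c T $ i \<le> ln \<Phi>"
      by (simp add: ln_ge_iff \<Phi>_def hedge_potential_pos)
    then show ?thesis by (simp add: hedge_eta_def)
  qed
  obtain z where z: "z \<in> prob_simplex"
    and z_min: "(\<Sum>t=1..T. (c (t - 1) + c t) \<bullet> z)
      = (INF y\<in>prob_simplex. \<Sum>t=1..T. (c (t - 1) + c t) \<bullet> y)"
    using alt_loss_min_attained[of c T] by blast
  have "- 8 * ln \<Phi> = (\<Sum>i\<in>UNIV. (- 8 * ln \<Phi>) * z $ i)"
    using z unfolding sum_distrib_left[symmetric] by (simp add: prob_simplex_def)
  also have "\<dots> \<le> (\<Sum>i\<in>UNIV. cum_loss c T $ i * z $ i)"
    using coord z by (intro sum_mono mult_right_mono) (auto simp: prob_simplex_def)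
  also have "\<dots> = (\<Sum>t=1..T. (c (t - 1) + c t) \<bullet> z)"
    unfolding inner_sum_left[symmetric] cum_loss_eq_sum[symmetric] by (simp add: inner_vec_def)
  finally show "alt_regret T c x \<le> 8 * ln (real CARD('d))"
    using ln_\<Phi> unfolding alt_regret_def z_min[symmetric] A_def by linarith
qed

end
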